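(* If $\mathcal{C}$ is a path category with a homotopy natural numbers object, then $\mathrm{Hex}(\mathcal{C})$ has a natural numbers object.
   Context: A path category is a category $\mathcal{C}$ with two classes of maps, fibrations and weak equivalences (maps in both classes are called acyclic fibrations), such that: (1) fibrations are closed under composition; (2) the pullback of a fibration along any map exists and is a fibration; (3) the pullback of an acyclic fibration along any map is an acyclic fibration; (4) 2-out-of-6: if $f:A\to B$, $g:B\to C$, $h:C\to D$ and $gf$, $hg$ are weak equivalences, then so are $f,g,h,hgf$; (5) isomorphisms are acyclic fibrations and every acyclic fibration has a section; (6) every object $B$ has a path object, i.e. a factorisation of the diagonal $B \to B\times B$ as a weak equivalence $r: B \to PB$ followed by a fibration $(s,t): PB \to B \times B$; (7) there is a terminal object $1$ and every map $X \to 1$ is a fibration. In a path category, $f,g: Y \to X$ are homotopic, $f \simeq g$, if for some path object $PX$ there is $h: Y \to PX$ with $sh = f$, $th = g$; this is a congruence independent of the choice of path object. A homotopy natural numbers object is an object $\mathbb{N}$ with maps $0: 1\to\mathbb{N}$ and $\sigma:\mathbb{N}\to\mathbb{N}$ such that for any $y_0: 1\to Y$ and $g: Y\to Y$ there is a map $h:\mathbb{N}\to Y$, unique up to homotopy, with $h0\simeq y_0$ and $h\sigma\simeq gh$. A homotopy equivalence relation on $X$ in $\mathcal{C}$ is a fibration $p=(p_1,p_2): R \to X \times X$ such that there exist: $\rho: X \to R$ with $p\rho = \Delta_X$; $\sigma: R \to R$ with $p_1\sigma = p_2$, $p_2\sigma = p_1$; and, for the pullback $R\times_X R$ of $p_2$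 and $p_1$ with projections $q_1,q_2$ (so $p_2q_1 = p_1q_2$), a map $\tau: R\times_X R \to R$ with $p_1\tau = p_1q_1$ and $p_2\tau = p_2q_2$. $\mathrm{Hex}(\mathcal{C})$ has as objects the pairs $(X, \rho: R \to X\times X)$ with $\rho$ a homotopy equivalence relation in $\mathcal{C}$. A morphism $(X,\rho:R\to X\times X) \to (Y,\sigma: S\to Y\times Y)$ is an equivalence class of maps $f: X \to Y$ in $\mathcal{C}$ for which there is $\varphi: R \to S$ with $\sigma\varphi = (f\times f)\rho$; two such $f,g$ are identified if there is $H: X \to S$ with $\sigma H = (f,g)$. *)

theory Defs
  imports Main
begin

section \<open>Categories\<close>

text \<open>
  Composition is a total function, written in the usual applicative order; it is only
  constrained on composable pairs of arrows.
\<close>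

record ('o, 'a) cat =
  Obj :: "'o set"
  Arr :: "'a set"
  Dom :: "'a \<Rightarrow> 'o"
  Cod :: "'a \<Rightarrow> 'o"
  Ident :: "'o \<Rightarrow> 'a"
  Comp :: "'a \<Rightarrow> 'a \<Rightarrow> 'a"  (infixr "\<cdot>\<index>" 70)

definition hom :: "('o, 'a, 'm) cat_scheme \<Rightarrow> 'o \<Rightarrow> 'o \<Rightarrow> 'a set" where
  "hom C X Y = {f \<in> Arr C. Dom C f = X \<and> Cod C f = Y}"

locale category =
  fixes C :: "('o, 'a, 'm) cat_scheme" (structure)
  assumes Dom_Obj: "f \<in> Arr C \<Longrightarrow> Dom C f \<in> Obj C"
    and Cod_Obj: "f \<in> Arr C \<Longrightarrow> Cod C f \<in> Obj C"
    and Ident_hom: "X \<in> Obj C \<Longrightarrow> Ident C X \<in> hom C X X"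
    and Comp_hom: "\<lbrakk>f \<in> hom C X Y; g \<in> hom C Y Z\<rbrakk> \<Longrightarrow> g \<cdot> f \<in> hom C X Z"
    and Comp_Ident: "f \<in> hom C X Y \<Longrightarrow> f \<cdot> Ident C X = f"
    and Ident_Comp: "f \<in> hom C X Y \<Longrightarrow> Ident C Y \<cdot> f = f"
    and Comp_assoc: "\<lbrakk>f \<in> hom C X Y; g \<in> hom C Y Z; h \<in> hom C Z W\<rbrakk>
        \<Longrightarrow> (h \<cdot> g) \<cdot> f = h \<cdot> (g \<cdot> f)"

definition terminal :: "('o, 'a, 'm) cat_scheme \<Rightarrow> 'o \<Rightarrow> bool" where
  "terminal C T \<longleftrightarrow> T \<in> Obj C \<and> (\<forall>X \<in> Obj C. \<exists>!f. f \<in> hom C X T)"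

definition iso :: "('o, 'a, 'm) cat_scheme \<Rightarrow> 'a \<Rightarrow> bool" where
  "iso C f \<longleftrightarrow> f \<in> Arr C \<and> (\<exists>g \<in> hom C (Cod C f) (Dom C f).
     g \<cdot>\<^bsub>C\<^esub> f = Ident C (Dom C f) \<and> f \<cdot>\<^bsub>C\<^esub> g = Ident C (Cod C f))"

text \<open>
  \<open>is_pullback C f g p q\<close>: the square with \<open>f \<cdot> p = g \<cdot> q\<close> is a pullback; \<open>p\<close> is the
  pullback of \<open>g\<close> along \<open>f\<close>.
\<close>

definition is_pullback :: "('o, 'a, 'm) cat_scheme \<Rightarrow> 'a \<Rightarrow> 'a \<Rightarrow> 'a \<Rightarrow> 'a \<Rightarrow> bool" where
  "is_pullback C f g p q \<longleftrightarrow>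
     f \<in> Arr C \<and> g \<in> Arr C \<and> Cod C f = Cod C g \<and>
     p \<in> hom C (Dom C p) (Dom C f) \<and> q \<in> hom C (Dom C p) (Dom C g) \<and>
     f \<cdot>\<^bsub>C\<^esub> p = g \<cdot>\<^bsub>C\<^esub> q \<and>
     (\<forall>Z. \<forall>u \<in> hom C Z (Dom C f). \<forall>v \<in> hom C Z (Dom C g). f \<cdot>\<^bsub>C\<^esub> u = g \<cdot>\<^bsub>C\<^esub> v \<longrightarrow>
        (\<exists>!h. h \<in> hom C Z (Dom C p) \<and> p \<cdot>\<^bsub>C\<^esub> h = u \<and> q \<cdot>\<^bsub>C\<^esub> h = v))"

definition is_product :: "('o, 'a, 'm) cat_scheme \<Rightarrow> 'o \<Rightarrow> 'o \<Rightarrow> 'a \<Rightarrow> 'a \<Rightarrow> bool" where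
  "is_product C X Y p q \<longleftrightarrow>
     p \<in> hom C (Dom C p) X \<and> q \<in> hom C (Dom C p) Y \<and>
     (\<forall>Z. \<forall>u \<in> hom C Z X. \<forall>v \<in> hom C Z Y.
        \<exists>!h. h \<in> hom C Z (Dom C p) \<and> p \<cdot>\<^bsub>C\<^esub> h = u \<and> q \<cdot>\<^bsub>C\<^esub> h = v)"

text \<open>
  \<open>X \<times> Y\<close> is a product selected by the choice operator; \<open>pr1\<close>, \<open>pr2\<close> and \<open>pair\<close> are
  meaningful whenever some product exists, as is the case in every path category.
\<close>

definition pr1 :: "('o, 'a, 'm) cat_scheme \<Rightarrow> 'o \<Rightarrow> 'o \<Rightarrow> 'a" where
  "pr1 C X Y = fst (SOME pq. is_product C X Y (fst pq) (snd pq))"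

definition pr2 :: "('o, 'a, 'm) cat_scheme \<Rightarrow> 'o \<Rightarrow> 'o \<Rightarrow> 'a" where
  "pr2 C X Y = snd (SOME pq. is_product C X Y (fst pq) (snd pq))"

definition prod_obj :: "('o, 'a, 'm) cat_scheme \<Rightarrow> 'o \<Rightarrow> 'o \<Rightarrow> 'o" where
  "prod_obj C X Y = Dom C (pr1 C X Y)"

definition pair :: "('o, 'a, 'm) cat_scheme \<Rightarrow> 'a \<Rightarrow> 'a \<Rightarrow> 'a" where
  "pair C f g = (THE h. h \<in> hom C (Dom C f) (prod_obj C (Cod C f) (Cod C g)) \<and>
     pr1 C (Cod C f) (Cod C g) \<cdot>\<^bsub>C\<^esub> h = f \<and> pr2 C (Cod C f) (Cod C g) \<cdot>\<^bsub>C\<^esub> h = g)"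

definition diag :: "('o, 'a, 'm) cat_scheme \<Rightarrow> 'o \<Rightarrow> 'a" where
  "diag C X = pair C (Ident C X) (Ident C X)"

definition prod_map :: "('o, 'a, 'm) cat_scheme \<Rightarrow> 'a \<Rightarrow> 'a \<Rightarrow> 'a" where
  "prod_map C f g =
     pair C (f \<cdot>\<^bsub>C\<^esub> pr1 C (Dom C f) (Dom C g)) (g \<cdot>\<^bsub>C\<^esub> pr2 C (Dom C f) (Dom C g))"

definition is_nno :: "('o, 'a, 'm) cat_scheme \<Rightarrow> 'o \<Rightarrow> 'o \<Rightarrow> 'a \<Rightarrow> 'a \<Rightarrow> bool" where
  "is_nno C T N z s \<longleftrightarrow>
     terminal C T \<and> z \<in> hom C T N \<and> s \<in> hom C N N \<and>
     (\<forall>Y. \<forall>y \<in> hom C T Y. \<forall>g \<in> hom C Y Y.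
        \<exists>!h. h \<in> hom C N Y \<and> h \<cdot>\<^bsub>C\<^esub> z = y \<and> h \<cdot>\<^bsub>C\<^esub> s = g \<cdot>\<^bsub>C\<^esub> h)"

definition has_nno :: "('o, 'a, 'm) cat_scheme \<Rightarrow> bool" where
  "has_nno C \<longleftrightarrow> (\<exists>T N z s. is_nno C T N z s)"

section \<open>Path categories\<close>

record ('o, 'a) path_cat = "('o, 'a) cat" +
  Fib :: "'a set"
  Weq :: "'a set"

definition is_path_object :: "('o, 'a) path_cat \<Rightarrow> 'o \<Rightarrow> 'a \<Rightarrow> 'a \<Rightarrow> bool" where
  "is_path_object C B r p \<longleftrightarrow>
     r \<in> Weq C \<and> p \<in> Fib C \<and>
     r \<in> hom C B (Dom C p) \<and> p \<in> hom C (Dom C p) (prod_obj C B B) \<and>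
     p \<cdot>\<^bsub>C\<^esub> r = diag C B"

locale path_category = category C
  for C :: "('o, 'a) path_cat" (structure) +
  assumes Fib_Arr: "Fib C \<subseteq> Arr C"
    and Weq_Arr: "Weq C \<subseteq> Arr C"
    and Fib_Comp: "\<lbrakk>f \<in> Fib C; g \<in> Fib C; Cod C f = Dom C g\<rbrakk> \<Longrightarrow> g \<cdot> f \<in> Fib C"
    and Fib_pullback_ex:
      "\<lbrakk>p \<in> Fib C; f \<in> Arr C; Cod C f = Cod C p\<rbrakk> \<Longrightarrow> \<exists>p' f'. is_pullback C f p p' f'"
    and Fib_pullback: "\<lbrakk>p \<in> Fib C; is_pullback C f p p' f'\<rbrakk> \<Longrightarrow> p' \<in> Fib C"
    and acyclic_pullback:
      "\<lbrakk>p \<in> Fib C \<inter> Weq C; is_pullback C f p p' f'\<rbrakk> \<Longrightarrow> p' \<in> Fib C \<inter> Weq C"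
    and two_out_of_six:
      "\<lbrakk>f \<in> hom C X Y; g \<in> hom C Y Z; h \<in> hom C Z W; g \<cdot> f \<in> Weq C; h \<cdot> g \<in> Weq C\<rbrakk>
        \<Longrightarrow> f \<in> Weq C \<and> g \<in> Weq C \<and> h \<in> Weq C \<and> h \<cdot> (g \<cdot> f) \<in> Weq C"
    and iso_acyclic: "iso C f \<Longrightarrow> f \<in> Fib C \<inter> Weq C"
    and acyclic_section:
      "p \<in> Fib C \<inter> Weq C \<Longrightarrow> \<exists>s \<in> hom C (Cod C p) (Dom C p). p \<cdot> s = Ident C (Cod C p)"
    and path_object_ex: "B \<in> Obj C \<Longrightarrow> \<exists>r p. is_path_object C B r p"
    and terminal_ex: "\<exists>T. terminal C T \<and> (\<forall>X. hom C X T \<subseteq> Fib C)"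

definition homotopic :: "('o, 'a) path_cat \<Rightarrow> 'a \<Rightarrow> 'a \<Rightarrow> bool" where
  "homotopic C f g \<longleftrightarrow>
     f \<in> Arr C \<and> g \<in> hom C (Dom C f) (Cod C f) \<and>
     (\<exists>r p h. is_path_object C (Cod C f) r p \<and> h \<in> hom C (Dom C f) (Dom C p) \<and>
        (pr1 C (Cod C f) (Cod C f) \<cdot>\<^bsub>C\<^esub> p) \<cdot>\<^bsub>C\<^esub> h = f \<and>
        (pr2 C (Cod C f) (Cod C f) \<cdot>\<^bsub>C\<^esub> p) \<cdot>\<^bsub>C\<^esub> h = g)"

definition is_homotopy_nno ::
    "('o, 'a) path_cat \<Rightarrow> 'o \<Rightarrow> 'o \<Rightarrow> 'a \<Rightarrow> 'a \<Rightarrow> bool" where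
  "is_homotopy_nno C T N z s \<longleftrightarrow>
     terminal C T \<and> z \<in> hom C T N \<and> s \<in> hom C N N \<and>
     (\<forall>Y. \<forall>y \<in> hom C T Y. \<forall>g \<in> hom C Y Y.
        \<exists>h \<in> hom C N Y.
          homotopic C (h \<cdot>\<^bsub>C\<^esub> z) y \<and> homotopic C (h \<cdot>\<^bsub>C\<^esub> s) (g \<cdot>\<^bsub>C\<^esub> h) \<and>
          (\<forall>h' \<in> hom C N Y.
             homotopic C (h' \<cdot>\<^bsub>C\<^esub> z) y \<and> homotopic C (h' \<cdot>\<^bsub>C\<^esub> s) (g \<cdot>\<^bsub>C\<^esub> h') \<longrightarrow>
             homotopic C h' h))"

definition has_homotopy_nno :: "('o, 'a) path_cat \<Rightarrow> bool" where
  "has_homotopy_nno C \<longleftrightarrow> (\<exists>T N z s. is_homotopy_nno C T N z s)"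

section \<open>The homotopy exact completion\<close>

definition is_homotopy_equiv_rel :: "('o, 'a) path_cat \<Rightarrow> 'o \<Rightarrow> 'a \<Rightarrow> bool" where
  "is_homotopy_equiv_rel C X p \<longleftrightarrow>
     X \<in> Obj C \<and> p \<in> Fib C \<and> Cod C p = prod_obj C X X \<and>
     (let R = Dom C p; p1 = pr1 C X X \<cdot>\<^bsub>C\<^esub> p; p2 = pr2 C X X \<cdot>\<^bsub>C\<^esub> p in
        (\<exists>\<rho> \<in> hom C X R. p \<cdot>\<^bsub>C\<^esub> \<rho> = diag C X) \<and>
        (\<exists>\<sigma> \<in> hom C R R. p1 \<cdot>\<^bsub>C\<^esub> \<sigma> = p2 \<and> p2 \<cdot>\<^bsub>C\<^esub> \<sigma> = p1) \<and>
        (\<exists>q1 q2. is_pullback C p2 p1 q1 q2 \<and>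
           (\<exists>\<tau> \<in> hom C (Dom C q1) R.
              p1 \<cdot>\<^bsub>C\<^esub> \<tau> = p1 \<cdot>\<^bsub>C\<^esub> q1 \<and> p2 \<cdot>\<^bsub>C\<^esub> \<tau> = p2 \<cdot>\<^bsub>C\<^esub> q2)))"

type_synonym ('o, 'a) hex_obj = "'o \<times> 'a"
type_synonym ('o, 'a) hex_arr = "('o, 'a) hex_obj \<times> 'a set \<times> ('o, 'a) hex_obj"

definition Hex_Obj :: "('o, 'a) path_cat \<Rightarrow> ('o, 'a) hex_obj set" where
  "Hex_Obj C = {(X, \<rho>). is_homotopy_equiv_rel C X \<rho>}"

definition hex_maps ::
    "('o, 'a) path_cat \<Rightarrow> ('o, 'a) hex_obj \<Rightarrow> ('o, 'a) hex_obj \<Rightarrow> 'a set" where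
  "hex_maps C A B = (case A of (X, \<rho>) \<Rightarrow> case B of (Y, \<sigma>) \<Rightarrow>
     {f \<in> hom C X Y. \<exists>\<phi> \<in> hom C (Dom C \<rho>) (Dom C \<sigma>).
        \<sigma> \<cdot>\<^bsub>C\<^esub> \<phi> = prod_map C f f \<cdot>\<^bsub>C\<^esub> \<rho>})"

definition hex_rel ::
    "('o, 'a) path_cat \<Rightarrow> ('o, 'a) hex_obj \<Rightarrow> ('o, 'a) hex_obj \<Rightarrow> ('a \<times> 'a) set" where
  "hex_rel C A B = (case A of (X, \<rho>) \<Rightarrow> case B of (Y, \<sigma>) \<Rightarrow>
     {(f, g). f \<in> hex_maps C A B \<and> g \<in> hex_maps C A B \<and>
        (\<exists>H \<in> hom C X (Dom C \<sigma>). \<sigma> \<cdot>\<^bsub>C\<^esub> H = pair C f g)})"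

text \<open>
  Arrows carry their endpoints, since one and the same class of maps may
  represent morphisms between different objects.
\<close>

definition Hex_Arr :: "('o, 'a) path_cat \<Rightarrow> ('o, 'a) hex_arr set" where
  "Hex_Arr C = {(A, F, B). A \<in> Hex_Obj C \<and> B \<in> Hex_Obj C \<and>
     F \<in> hex_maps C A B // hex_rel C A B}"

definition Hex_Ident :: "('o, 'a) path_cat \<Rightarrow> ('o, 'a) hex_obj \<Rightarrow> ('o, 'a) hex_arr" where
  "Hex_Ident C A = (A, hex_rel C A A `` {Ident C (fst A)}, A)"

definition Hex_Comp ::
    "('o, 'a) path_cat \<Rightarrow> ('o, 'a) hex_arr \<Rightarrow> ('o, 'a) hex_arr \<Rightarrow> ('o, 'a) hex_arr" where
  "Hex_Comp C G F = (case F of (A, f, _) \<Rightarrow> case G of (_, g, B) \<Rightarrow>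
     (A, \<Union>f' \<in> f. \<Union>g' \<in> g. hex_rel C A B `` {g' \<cdot>\<^bsub>C\<^esub> f'}, B))"

definition Hex :: "('o, 'a) path_cat \<Rightarrow> (('o, 'a) hex_obj, ('o, 'a) hex_arr) cat" where
  "Hex C = \<lparr>Obj = Hex_Obj C, Arr = Hex_Arr C, Dom = (\<lambda>(A, _, _). A), Cod = (\<lambda>(_, _, B). B),
     Ident = Hex_Ident C, Comp = Hex_Comp C\<rparr>"


section \<open>\<open>Hex C\<close> is a category\<close>

lemma homD: "f \<in> hom C X Y \<Longrightarrow> f \<in> Arr C \<and> Dom C f = X \<and> Cod C f = Y"
  by (simp add: hom_def)

context path_category
begin

lemma hom_Obj: "f \<in> hom C X Y \<Longrightarrow> X \<in> Obj C \<and> Y \<in> Obj C"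
  using Dom_Obj Cod_Obj by (auto simp: hom_def)

lemma product_ex:
  assumes X: "X \<in> Obj C" and Y: "Y \<in> Obj C"
  shows "\<exists>p q. is_product C X Y p q"
proof -
  obtain T where T: "terminal C T" and fib: "\<And>X. hom C X T \<subseteq> Fib C"
    using terminal_ex by blast
  obtain f where f: "f \<in> hom C X T" using T X unfolding terminal_def by blast
  obtain g where g: "g \<in> hom C Y T" using T Y unfolding terminal_def by blast
  have "g \<in> Fib C" "f \<in> Arr C" "Cod C f = Cod C g"
    using fib g f by (auto simp: hom_def)
  then obtain p q where pb: "is_pullback C f g p q"
    using Fib_pullback_ex by blast
  have eq: "f \<cdot> u = g \<cdot> v" if "u \<in> hom C Z X" "v \<in> hom C Z Y" for u v Z
  proof -
    have "f \<cdot> u \<in> hom C Z T" "g \<cdot> v \<in> hom C Z T"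
      using that f g Comp_hom by blast+
    then show ?thesis using T hom_Obj[OF that(1)] unfolding terminal_def by blast
  qed
  have D: "Dom C f = X" "Dom C g = Y" using f g by (auto simp: hom_def)
  have "is_product C X Y p q"
    using pb eq unfolding is_pullback_def is_product_def D by blast
  then show ?thesis by blast
qed

lemma product_pr:
  assumes "X \<in> Obj C" "Y \<in> Obj C"
  shows "is_product C X Y (pr1 C X Y) (pr2 C X Y)"
proof -
  have "\<exists>pq. is_product C X Y (fst pq) (snd pq)"
    using product_ex[OF assms] by auto
  from someI_ex[OF this] show ?thesis unfolding pr1_def pr2_def .
qed

lemma pr_hom:
  assumes "X \<in> Obj C" "Y \<in> Obj C"
  shows "pr1 C X Y \<in> hom C (prod_obj C X Y) X" "pr2 C X Y \<in> hom C (prod_obj C X Y) Y"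
  using product_pr[OF assms] unfolding is_product_def prod_obj_def by auto

lemma pair:
  assumes f: "f \<in> hom C Z X" and g: "g \<in> hom C Z Y"
  shows "pair C f g \<in> hom C Z (prod_obj C X Y)"
    and "pr1 C X Y \<cdot> pair C f g = f" and "pr2 C X Y \<cdot> pair C f g = g"
proof -
  have "X \<in> Obj C" "Y \<in> Obj C" using f g hom_Obj by blast+
  from product_pr[OF this] f g
  have "\<exists>!h. h \<in> hom C Z (prod_obj C X Y) \<and> pr1 C X Y \<cdot> h = f \<and> pr2 C X Y \<cdot> h = g"
    unfolding is_product_def prod_obj_def by blast
  from theI'[OF this] homD[OF f] homD[OF g]
  show "pair C f g \<in> hom C Z (prod_obj C X Y)"
    and "pr1 C X Y \<cdot> pair C f g = f" and "pr2 C X Y \<cdot> pair C f g = g"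
    unfolding pair_def by simp_all
qed

lemma prod_eqI:
  assumes h: "h \<in> hom C Z (prod_obj C X Y)" and h': "h' \<in> hom C Z (prod_obj C X Y)"
    and o: "X \<in> Obj C" "Y \<in> Obj C"
    and eq: "pr1 C X Y \<cdot> h = pr1 C X Y \<cdot> h'" "pr2 C X Y \<cdot> h = pr2 C X Y \<cdot> h'"
  shows "h = h'"
proof -
  have "pr1 C X Y \<cdot> h \<in> hom C Z X" "pr2 C X Y \<cdot> h \<in> hom C Z Y"
    using h pr_hom[OF o] Comp_hom by blast+
  with product_pr[OF o]
  have "\<exists>!k. k \<in> hom C Z (prod_obj C X Y) \<and> pr1 C X Y \<cdot> k = pr1 C X Y \<cdot> h
      \<and> pr2 C X Y \<cdot> k = pr2 C X Y \<cdot> h"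
    unfolding is_product_def prod_obj_def by blast
  with h h' eq show ?thesis by metis
qed

text \<open>
  \<open>related Y p f g\<close>: the generalised elements \<open>f\<close>, \<open>g\<close> of \<open>Y\<close> are identified by \<open>p\<close>.
\<close>

definition related :: "'o \<Rightarrow> 'a \<Rightarrow> 'a \<Rightarrow> 'a \<Rightarrow> bool" where
  "related Y p f g \<longleftrightarrow> (\<exists>Z. f \<in> hom C Z Y \<and> g \<in> hom C Z Y \<and>
     (\<exists>H \<in> hom C Z (Dom C p). p \<cdot> H = pair C f g))"

lemma equiv_rel_hom:
  assumes "is_homotopy_equiv_rel C X p"
  shows "X \<in> Obj C" "p \<in> hom C (Dom C p) (prod_obj C X X)"
    "pr1 C X X \<cdot> p \<in> hom C (Dom C p) X" "pr2 C X X \<cdot> p \<in> hom C (Dom C p) X"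
proof -
  show X: "X \<in> Obj C" and p: "p \<in> hom C (Dom C p) (prod_obj C X X)"
    using assms Fib_Arr unfolding is_homotopy_equiv_rel_def hom_def by auto
  show "pr1 C X X \<cdot> p \<in> hom C (Dom C p) X" "pr2 C X X \<cdot> p \<in> hom C (Dom C p) X"
    using Comp_hom[OF p] pr_hom[OF X X] by blast+
qed

lemma related_iff:
  assumes R: "is_homotopy_equiv_rel C X p" and f: "f \<in> hom C Z X"
  shows "related X p f g \<longleftrightarrow> (\<exists>H \<in> hom C Z (Dom C p).
    (pr1 C X X \<cdot> p) \<cdot> H = f \<and> (pr2 C X X \<cdot> p) \<cdot> H = g)"
proof
  note r = equiv_rel_hom[OF R]
  note pr = pr_hom[OF r(1) r(1)]
  assume "related X p f g"
  then obtain Z' H where 1: "f \<in> hom C Z' X" "g \<in> hom C Z' X" "H \<in> hom C Z' (Dom C p)"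
    "p \<cdot> H = pair C f g" unfolding related_def by blast
  have "Z' = Z" using 1 f by (auto simp: hom_def)
  with 1 show "\<exists>H \<in> hom C Z (Dom C p).
    (pr1 C X X \<cdot> p) \<cdot> H = f \<and> (pr2 C X X \<cdot> p) \<cdot> H = g"
    using Comp_assoc[OF 1(3) r(2) pr(1)] Comp_assoc[OF 1(3) r(2) pr(2)] pair[OF 1(1,2)]
    by auto
next
  note r = equiv_rel_hom[OF R]
  note pr = pr_hom[OF r(1) r(1)]
  assume "\<exists>H \<in> hom C Z (Dom C p).
    (pr1 C X X \<cdot> p) \<cdot> H = f \<and> (pr2 C X X \<cdot> p) \<cdot> H = g"
  then obtain H where H: "H \<in> hom C Z (Dom C p)"
    and f': "(pr1 C X X \<cdot> p) \<cdot> H = f" and g': "(pr2 C X X \<cdot> p) \<cdot> H = g" by blast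
  have g: "g \<in> hom C Z X" using Comp_hom[OF H r(4)] g' by simp
  have "p \<cdot> H = pair C f g"
    by (rule prod_eqI[OF Comp_hom[OF H r(2)] pair(1)[OF f g] r(1) r(1)])
      (use pair[OF f g] Comp_assoc[OF H r(2) pr(1)] Comp_assoc[OF H r(2) pr(2)] f' g'
        in auto)
  with f g H show "related X p f g" unfolding related_def by blast
qed

lemma related_refl:
  assumes R: "is_homotopy_equiv_rel C X p" and f: "f \<in> hom C Z X"
  shows "related X p f f"
proof -
  note r = equiv_rel_hom[OF R]
  note pr = pr_hom[OF r(1) r(1)]
  obtain \<rho> where h: "\<rho> \<in> hom C X (Dom C p)" and e: "p \<cdot> \<rho> = diag C X"
    using R unfolding is_homotopy_equiv_rel_def Let_def by blast
  note d = pair[OF Ident_hom[OF r(1)] Ident_hom[OF r(1)]]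
  have "(pr1 C X X \<cdot> p) \<cdot> (\<rho> \<cdot> f) = f" "(pr2 C X X \<cdot> p) \<cdot> (\<rho> \<cdot> f) = f"
    using Comp_assoc[OF f h r(3)] Comp_assoc[OF f h r(4)] Ident_Comp[OF f]
      Comp_assoc[OF h r(2) pr(1)] Comp_assoc[OF h r(2) pr(2)] d(2,3) e
    unfolding diag_def by simp_all
  then show ?thesis using related_iff[OF R f] Comp_hom[OF f h] by blast
qed

lemma related_sym:
  assumes R: "is_homotopy_equiv_rel C X p" and fg: "related X p f g"
  shows "related X p g f"
proof -
  note r = equiv_rel_hom[OF R]
  obtain Z where f: "f \<in> hom C Z X" and g: "g \<in> hom C Z X"
    using fg unfolding related_def by blast
  obtain H where H: "H \<in> hom C Z (Dom C p)"
    and e: "(pr1 C X X \<cdot> p) \<cdot> H = f" "(pr2 C X X \<cdot> p) \<cdot> H = g"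
    using fg related_iff[OF R f] by blast
  obtain \<sigma> where h: "\<sigma> \<in> hom C (Dom C p) (Dom C p)"
    and s: "(pr1 C X X \<cdot> p) \<cdot> \<sigma> = pr2 C X X \<cdot> p" "(pr2 C X X \<cdot> p) \<cdot> \<sigma> = pr1 C X X \<cdot> p"
    using R unfolding is_homotopy_equiv_rel_def Let_def by blast
  have "(pr1 C X X \<cdot> p) \<cdot> (\<sigma> \<cdot> H) = g" "(pr2 C X X \<cdot> p) \<cdot> (\<sigma> \<cdot> H) = f"
    using Comp_assoc[OF H h r(3)] Comp_assoc[OF H h r(4)] e s by auto
  then show ?thesis using related_iff[OF R g] Comp_hom[OF H h] by blast
qed

lemma related_trans:
  assumes R: "is_homotopy_equiv_rel C X p"
    and fg: "related X p f g" and gk: "related X p g k"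
  shows "related X p f k"
proof -
  note r = equiv_rel_hom[OF R]
  obtain Z where f: "f \<in> hom C Z X" and g: "g \<in> hom C Z X"
    using fg unfolding related_def by blast
  let ?p1 = "pr1 C X X \<cdot> p" and ?p2 = "pr2 C X X \<cdot> p"
  obtain H where H: "H \<in> hom C Z (Dom C p)" and e: "?p1 \<cdot> H = f" "?p2 \<cdot> H = g"
    using fg related_iff[OF R f] by blast
  obtain K where K: "K \<in> hom C Z (Dom C p)" and d: "?p1 \<cdot> K = g" "?p2 \<cdot> K = k"
    using gk related_iff[OF R g] by blast
  obtain q1 q2 \<tau> where pb: "is_pullback C ?p2 ?p1 q1 q2"
    and t: "\<tau> \<in> hom C (Dom C q1) (Dom C p)"
    and te: "?p1 \<cdot> \<tau> = ?p1 \<cdot> q1" "?p2 \<cdot> \<tau> = ?p2 \<cdot> q2"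
    using R unfolding is_homotopy_equiv_rel_def Let_def by blast
  have D: "Dom C ?p1 = Dom C p" "Dom C ?p2 = Dom C p" using r by (auto simp: hom_def)
  have q: "q1 \<in> hom C (Dom C q1) (Dom C p)" "q2 \<in> hom C (Dom C q1) (Dom C p)"
    using pb unfolding is_pullback_def D by auto
  obtain L where L: "L \<in> hom C Z (Dom C q1)" "q1 \<cdot> L = H" "q2 \<cdot> L = K"
    using pb H K e(2) d(1) unfolding is_pullback_def D by metis
  have "?p1 \<cdot> (\<tau> \<cdot> L) = f" "?p2 \<cdot> (\<tau> \<cdot> L) = k"
    using Comp_assoc[OF L(1) t r(3)] Comp_assoc[OF L(1) t r(4)] te L e d
      Comp_assoc[OF L(1) q(1) r(3)] Comp_assoc[OF L(1) q(2) r(4)] by auto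
  then show ?thesis using related_iff[OF R f] Comp_hom[OF L(1) t] by blast
qed

lemma related_precomp:
  assumes R: "is_homotopy_equiv_rel C X p"
    and fg: "related X p f g" and f: "f \<in> hom C Z X" and k: "k \<in> hom C W Z"
  shows "related X p (f \<cdot> k) (g \<cdot> k)"
proof -
  note r = equiv_rel_hom[OF R]
  obtain H where H: "H \<in> hom C Z (Dom C p)"
    and e: "(pr1 C X X \<cdot> p) \<cdot> H = f" "(pr2 C X X \<cdot> p) \<cdot> H = g"
    using fg related_iff[OF R f] by blast
  show ?thesis
    using related_iff[OF R Comp_hom[OF k f]] Comp_hom[OF k H]
      Comp_assoc[OF k H r(3)] Comp_assoc[OF k H r(4)] e by metis
qed

lemma hex_maps_iff:
  assumes R: "is_homotopy_equiv_rel C X p" and S: "is_homotopy_equiv_rel C Y s"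
  shows "f \<in> hex_maps C (X, p) (Y, s) \<longleftrightarrow>
    f \<in> hom C X Y \<and> (\<forall>x y. related X p x y \<longrightarrow> related Y s (f \<cdot> x) (f \<cdot> y))"
    (is "?L \<longleftrightarrow> ?M \<and> ?N")
proof (cases ?M)
  case f: True
  note r = equiv_rel_hom[OF R] and t = equiv_rel_hom[OF S]
  note prX = pr_hom[OF r(1) r(1)] and prY = pr_hom[OF t(1) t(1)]
  let ?p1 = "pr1 C X X \<cdot> p" and ?p2 = "pr2 C X X \<cdot> p"
  let ?s1 = "pr1 C Y Y \<cdot> s" and ?s2 = "pr2 C Y Y \<cdot> s"
  note fp = Comp_hom[OF r(3) f] Comp_hom[OF r(4) f]
  have pm: "prod_map C f f \<in> hom C (prod_obj C X X) (prod_obj C Y Y)"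
    "pr1 C Y Y \<cdot> prod_map C f f = f \<cdot> pr1 C X X"
    "pr2 C Y Y \<cdot> prod_map C f f = f \<cdot> pr2 C X X"
    using pair[OF Comp_hom[OF prX(1) f] Comp_hom[OF prX(2) f]] homD[OF f]
    unfolding prod_map_def by simp_all
  have e: "prod_map C f f \<cdot> p = pair C (f \<cdot> ?p1) (f \<cdot> ?p2)"
    by (rule prod_eqI[OF Comp_hom[OF r(2) pm(1)] pair(1)[OF fp] t(1) t(1)])
      (use pair[OF fp] pm(2,3) Comp_assoc[OF r(2) pm(1) prY(1)]
        Comp_assoc[OF r(2) pm(1) prY(2)] Comp_assoc[OF r(2) prX(1) f]
        Comp_assoc[OF r(2) prX(2) f] in auto)
  have 1: "?L \<longleftrightarrow> related Y s (f \<cdot> ?p1) (f \<cdot> ?p2)"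
  proof -
    have "Z = Dom C p" if "f \<cdot> ?p1 \<in> hom C Z Y" for Z
      using homD[OF that] homD[OF fp(1)] by simp
    then have "related Y s (f \<cdot> ?p1) (f \<cdot> ?p2) \<longleftrightarrow>
        (\<exists>H \<in> hom C (Dom C p) (Dom C s). s \<cdot> H = pair C (f \<cdot> ?p1) (f \<cdot> ?p2))"
      unfolding related_def using fp by blast
    with f e show ?thesis unfolding hex_maps_def by simp
  qed
  have 2: "related Y s (f \<cdot> x) (f \<cdot> y)"
    if a: "related Y s (f \<cdot> ?p1) (f \<cdot> ?p2)" and b: "related X p x y" for x y
  proof -
    obtain Z where x: "x \<in> hom C Z X" using b unfolding related_def by blast
    obtain H where H: "H \<in> hom C Z (Dom C p)" "?p1 \<cdot> H = x" "?p2 \<cdot> H = y"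
      using b related_iff[OF R x] by blast
    show ?thesis using related_precomp[OF S a fp(1) H(1)]
      Comp_assoc[OF H(1) r(3) f] Comp_assoc[OF H(1) r(4) f] H by simp
  qed
  have 3: "related X p ?p1 ?p2"
  proof -
    have I: "Ident C (Dom C p) \<in> hom C (Dom C p) (Dom C p)"
      using hom_Obj[OF r(2)] Ident_hom by blast
    show ?thesis using related_iff[OF R r(3)] I Comp_Ident[OF r(3)] Comp_Ident[OF r(4)]
      by blast
  qed
  show ?thesis using 1 2 3 f by blast
next
  case False
  then show ?thesis by (auto simp: hex_maps_def)
qed

lemma hex_rel_iff:
  "(f, g) \<in> hex_rel C (X, p) (Y, s) \<longleftrightarrow>
    f \<in> hex_maps C (X, p) (Y, s) \<and> g \<in> hex_maps C (X, p) (Y, s) \<and> related Y s f g"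
  unfolding hex_rel_def hex_maps_def related_def by (auto dest: homD)

lemma equiv_hex_rel:
  assumes "A \<in> Hex_Obj C" "B \<in> Hex_Obj C"
  shows "equiv (hex_maps C A B) (hex_rel C A B)"
proof -
  obtain X p Y s where AB: "A = (X, p)" "B = (Y, s)" by (cases A, cases B)
  with assms have R: "is_homotopy_equiv_rel C X p" and S: "is_homotopy_equiv_rel C Y s"
    by (auto simp: Hex_Obj_def)
  show ?thesis unfolding AB
  proof (rule equivI)
    show "hex_rel C (X, p) (Y, s) \<subseteq> hex_maps C (X, p) (Y, s) \<times> hex_maps C (X, p) (Y, s)"
      by (auto simp: hex_rel_iff)
    show "refl_on (hex_maps C (X, p) (Y, s)) (hex_rel C (X, p) (Y, s))"
      by (rule refl_onI)
        (auto simp: hex_rel_iff hex_maps_iff[OF R S] intro: related_refl[OF S])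
    show "sym (hex_rel C (X, p) (Y, s))"
      by (rule symI) (auto simp: hex_rel_iff intro: related_sym[OF S])
    show "trans (hex_rel C (X, p) (Y, s))"
      by (rule transI) (auto simp: hex_rel_iff intro: related_trans[OF S])
  qed
qed

lemma Ident_hex_maps:
  assumes "A \<in> Hex_Obj C"
  shows "Ident C (fst A) \<in> hex_maps C A A"
proof -
  obtain X p where A: "A = (X, p)" by (cases A)
  with assms have R: "is_homotopy_equiv_rel C X p" by (simp add: Hex_Obj_def)
  have "related X p (Ident C X \<cdot> x) (Ident C X \<cdot> y)" if "related X p x y" for x y
  proof -
    obtain Z where "x \<in> hom C Z X" "y \<in> hom C Z X"
      using \<open>related X p x y\<close> unfolding related_def by blast
    then show ?thesis using that Ident_Comp by simp
  qed
  then show ?thesis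
    using Ident_hom[OF equiv_rel_hom(1)[OF R]] unfolding A hex_maps_iff[OF R R] by simp
qed

lemma Comp_hex_maps:
  assumes "A \<in> Hex_Obj C" "B \<in> Hex_Obj C" "D \<in> Hex_Obj C"
    and f: "f \<in> hex_maps C A B" and g: "g \<in> hex_maps C B D"
  shows "g \<cdot> f \<in> hex_maps C A D"
proof -
  obtain X p Y s Z t where E: "A = (X, p)" "B = (Y, s)" "D = (Z, t)"
    by (cases A, cases B, cases D)
  with assms have R: "is_homotopy_equiv_rel C X p" "is_homotopy_equiv_rel C Y s"
    "is_homotopy_equiv_rel C Z t" by (auto simp: Hex_Obj_def)
  have f': "f \<in> hom C X Y" "\<And>x y. related X p x y \<Longrightarrow> related Y s (f \<cdot> x) (f \<cdot> y)"
    using f unfolding E hex_maps_iff[OF R(1,2)] by blast+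
  have g': "g \<in> hom C Y Z" "\<And>x y. related Y s x y \<Longrightarrow> related Z t (g \<cdot> x) (g \<cdot> y)"
    using g unfolding E hex_maps_iff[OF R(2,3)] by blast+
  have "related Z t ((g \<cdot> f) \<cdot> x) ((g \<cdot> f) \<cdot> y)" if xy: "related X p x y" for x y
  proof -
    obtain W where "x \<in> hom C W X" "y \<in> hom C W X" using xy unfolding related_def by blast
    then show ?thesis using g'(2)[OF f'(2)[OF xy]] Comp_assoc f'(1) g'(1) by metis
  qed
  then show ?thesis unfolding E hex_maps_iff[OF R(1,3)] using Comp_hom[OF f'(1) g'(1)] by blast
qed

lemma Comp_hex_rel:
  assumes "A \<in> Hex_Obj C" "B \<in> Hex_Obj C" "D \<in> Hex_Obj C"
    and f: "(f, f') \<in> hex_rel C A B" and g: "(g, g') \<in> hex_rel C B D"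
  shows "(g \<cdot> f, g' \<cdot> f') \<in> hex_rel C A D"
proof -
  obtain X p Y s Z t where E: "A = (X, p)" "B = (Y, s)" "D = (Z, t)"
    by (cases A, cases B, cases D)
  with assms have R: "is_homotopy_equiv_rel C X p" "is_homotopy_equiv_rel C Y s"
    "is_homotopy_equiv_rel C Z t" by (auto simp: Hex_Obj_def)
  have f1: "f \<in> hex_maps C A B" "f' \<in> hex_maps C A B" "related Y s f f'"
    and g1: "g \<in> hex_maps C B D" "g' \<in> hex_maps C B D" "related Z t g g'"
    using f g unfolding E hex_rel_iff by auto
  have h: "f' \<in> hom C X Y" "g \<in> hom C Y Z"
    using f1 g1 unfolding E hex_maps_iff[OF R(1,2)] hex_maps_iff[OF R(2,3)] by auto
  have "related Z t (g \<cdot> f) (g \<cdot> f')"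
    using g1(1) f1(3) unfolding E hex_maps_iff[OF R(2,3)] by blast
  moreover have "related Z t (g \<cdot> f') (g' \<cdot> f')"
    using related_precomp[OF R(3) g1(3) h(2,1)] .
  ultimately have "related Z t (g \<cdot> f) (g' \<cdot> f')" by (rule related_trans[OF R(3)])
  then show ?thesis using Comp_hex_maps[OF assms(1-3)] f1 g1 unfolding E hex_rel_iff by blast
qed

lemma hex_hom_iff:
  "F \<in> hom (Hex C) A B \<longleftrightarrow> A \<in> Hex_Obj C \<and> B \<in> Hex_Obj C \<and>
    (\<exists>f \<in> hex_maps C A B. F = (A, hex_rel C A B `` {f}, B))"
  by (cases F) (auto simp: hom_def Hex_def Hex_Arr_def quotient_def)

lemma Hex_Comp_class:
  assumes o: "A \<in> Hex_Obj C" "B \<in> Hex_Obj C" "D \<in> Hex_Obj C"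
    and f: "f \<in> hex_maps C A B" and g: "g \<in> hex_maps C B D"
  shows "Comp (Hex C) (B, hex_rel C B D `` {g}, D) (A, hex_rel C A B `` {f}, B) =
    (A, hex_rel C A D `` {g \<cdot> f}, D)"
proof -
  note eq = equiv_hex_rel[OF o(1,2)] equiv_hex_rel[OF o(2,3)] equiv_hex_rel[OF o(1,3)]
  have c: "hex_rel C A D `` {g' \<cdot> f'} = hex_rel C A D `` {g \<cdot> f}"
    if "f' \<in> hex_rel C A B `` {f}" "g' \<in> hex_rel C B D `` {g}" for f' g'
    using equiv_class_eq[OF eq(3) Comp_hex_rel[OF o]] that by (metis Image_singleton_iff)
  have "f \<in> hex_rel C A B `` {f}" "g \<in> hex_rel C B D `` {g}"
    using equiv_class_self[OF eq(1) f] equiv_class_self[OF eq(2) g] .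
  with c have "(\<Union>f' \<in> hex_rel C A B `` {f}. \<Union>g' \<in> hex_rel C B D `` {g}.
      hex_rel C A D `` {g' \<cdot> f'}) = hex_rel C A D `` {g \<cdot> f}"
    by blast
  then show ?thesis by (simp add: Hex_def Hex_Comp_def)
qed

lemma hex_maps_hom: "f \<in> hex_maps C A B \<Longrightarrow> f \<in> hom C (fst A) (fst B)"
  by (auto simp: hex_maps_def split: prod.splits)

theorem category_Hex: "category (Hex C)"
proof
  fix F assume "F \<in> Arr (Hex C)"
  then show "Dom (Hex C) F \<in> Obj (Hex C)" "Cod (Hex C) F \<in> Obj (Hex C)"
    by (auto simp: Hex_def Hex_Arr_def)
next
  have Id: "Ident (Hex C) A = (A, hex_rel C A A `` {Ident C (fst A)}, A)" for A
    by (simp add: Hex_def Hex_Ident_def)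
  fix A assume "A \<in> Obj (Hex C)"
  then have "A \<in> Hex_Obj C" by (simp add: Hex_def)
  with Ident_hex_maps Id show "Ident (Hex C) A \<in> hom (Hex C) A A"
    unfolding hex_hom_iff by blast
next
  fix A B D F G assume "F \<in> hom (Hex C) A B" "G \<in> hom (Hex C) B D"
  then show "Comp (Hex C) G F \<in> hom (Hex C) A D"
    unfolding hex_hom_iff using Hex_Comp_class Comp_hex_maps by blast
next
  have Id: "Ident (Hex C) A = (A, hex_rel C A A `` {Ident C (fst A)}, A)" for A
    by (simp add: Hex_def Hex_Ident_def)
  fix A B F assume "F \<in> hom (Hex C) A B"
  then obtain f where o: "A \<in> Hex_Obj C" "B \<in> Hex_Obj C" and f: "f \<in> hex_maps C A B"
    and F: "F = (A, hex_rel C A B `` {f}, B)" unfolding hex_hom_iff by blast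
  show "Comp (Hex C) F (Ident (Hex C) A) = F"
    unfolding F Id Hex_Comp_class[OF o(1,1,2) Ident_hex_maps[OF o(1)] f]
    using Comp_Ident[OF hex_maps_hom[OF f]] by simp
  show "Comp (Hex C) (Ident (Hex C) B) F = F"
    unfolding F Id Hex_Comp_class[OF o(1,2,2) f Ident_hex_maps[OF o(2)]]
    using Ident_Comp[OF hex_maps_hom[OF f]] by simp
next
  fix A B D E F G H
  assume "F \<in> hom (Hex C) A B" "G \<in> hom (Hex C) B D" "H \<in> hom (Hex C) D E"
  then obtain f g h where o: "A \<in> Hex_Obj C" "B \<in> Hex_Obj C" "D \<in> Hex_Obj C" "E \<in> Hex_Obj C"
    and f: "f \<in> hex_maps C A B" and g: "g \<in> hex_maps C B D" and h: "h \<in> hex_maps C D E"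
    and FGH: "F = (A, hex_rel C A B `` {f}, B)" "G = (B, hex_rel C B D `` {g}, D)"
      "H = (D, hex_rel C D E `` {h}, E)" unfolding hex_hom_iff by blast
  note gf = Comp_hex_maps[OF o(1,2,3) f g] and hg = Comp_hex_maps[OF o(2,3,4) g h]
  show "Comp (Hex C) (Comp (Hex C) H G) F = Comp (Hex C) H (Comp (Hex C) G F)"
    unfolding FGH Hex_Comp_class[OF o(1,2,3) f g] Hex_Comp_class[OF o(2,3,4) g h]
      Hex_Comp_class[OF o(1,3,4) gf h] Hex_Comp_class[OF o(1,2,4) f hg]
    using Comp_assoc[OF hex_maps_hom[OF f] hex_maps_hom[OF g] hex_maps_hom[OF h]] by simp
qed

end

end

theory Submission
  imports Defs
begin

text \<open>
  The natural numbers object of the completion is \<open>N\<close> with a path object as equivalence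
  relation. A fibration has the (lower) lifting property against weak equivalences, so a path object
  of \<open>X\<close> is the least homotopy equivalence relation on \<open>X\<close>, and every map out of \<open>X\<close>
  respects it; this gives existence. For uniqueness up to a relation \<open>S\<close> on \<open>Y\<close> of two solutions
  \<open>h\<close>, \<open>h'\<close>, pull \<open>S\<close> back along \<open>(h, h')\<close> to \<open>q : Q \<rightarrow> N\<close>. Zero and successor lift strictly
  to \<open>Q\<close>, so recursion yields \<open>k : N \<rightarrow> Q\<close> with \<open>q \<cdot> k\<close> homotopic to the identity,
  whence \<open>h \<sim> h \<cdot> q \<cdot> k \<sim> h' \<cdot> q \<cdot> k \<sim> h'\<close>.
\<close>

context path_category
begin

section \<open>Cancellation of weak equivalences and the calculus of pairs\<close>

text \<open>The 2-out-of-6 axiom for \<open>f\<close>, \<open>g\<close> and an identity, whose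
  consecutive composites are \<open>g \<cdot> f\<close> and \<open>g\<close>. The dual cancellation
  puts the identity first.\<close>

lemma Weq_cancel_left:
  assumes "f \<in> hom C X Y" "g \<in> hom C Y Z" "g \<cdot> f \<in> Weq C" "g \<in> Weq C"
  shows "f \<in> Weq C"
proof -
  have "Ident C Z \<in> hom C Z Z"
    using assms(2) hom_Obj Ident_hom by blast
  from two_out_of_six[OF assms(1,2) this] show ?thesis
    using assms Ident_Comp[OF assms(2)] by simp
qed

lemma Weq_cancel_right:
  assumes "f \<in> hom C X Y" "g \<in> hom C Y Z" "g \<cdot> f \<in> Weq C" "f \<in> Weq C"
  shows "g \<in> Weq C"
proof -
  have "Ident C X \<in> hom C X X"
    using assms(1) hom_Obj Ident_hom by blast
  from two_out_of_six[OF this assms(1,2)] show ?thesis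
    using assms Comp_Ident[OF assms(1)] by simp
qed

lemma Ident_Weq:
  assumes "X \<in> Obj C"
  shows "Ident C X \<in> Weq C"
proof -
  note I = Ident_hom[OF assms]
  have "iso C (Ident C X)"
    unfolding iso_def using I homD[OF I] Ident_Comp[OF I] by auto
  then show ?thesis using iso_acyclic by blast
qed

lemma pair_comp:
  assumes f: "f \<in> hom C Z X" and g: "g \<in> hom C Z Y" and k: "k \<in> hom C W Z"
  shows "pair C f g \<cdot> k = pair C (f \<cdot> k) (g \<cdot> k)"
proof -
  have o: "X \<in> Obj C" "Y \<in> Obj C" using f g hom_Obj by blast+
  note p = pair[OF f g] and pr = pr_hom[OF o]
  note q = pair[OF Comp_hom[OF k f] Comp_hom[OF k g]]
  show ?thesis
    by (rule prod_eqI[OF Comp_hom[OF k p(1)] q(1) o])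
      (use p q Comp_assoc[OF k p(1) pr(1)] Comp_assoc[OF k p(1) pr(2)] in auto)
qed

lemma pair_eta:
  assumes h: "h \<in> hom C Z (prod_obj C X Y)" and o: "X \<in> Obj C" "Y \<in> Obj C"
  shows "pair C (pr1 C X Y \<cdot> h) (pr2 C X Y \<cdot> h) = h"
proof -
  note q = pair[OF Comp_hom[OF h pr_hom(1)[OF o]] Comp_hom[OF h pr_hom(2)[OF o]]]
  show ?thesis by (rule prod_eqI[OF q(1) h o q(2,3)])
qed

lemma prod_map:
  assumes f: "f \<in> hom C X X'" and g: "g \<in> hom C Y Y'"
  shows "prod_map C f g \<in> hom C (prod_obj C X Y) (prod_obj C X' Y')"
    and "\<lbrakk>x \<in> hom C Z X; y \<in> hom C Z Y\<rbrakk> \<Longrightarrow>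
      prod_map C f g \<cdot> pair C x y = pair C (f \<cdot> x) (g \<cdot> y)"
proof -
  have o: "X \<in> Obj C" "Y \<in> Obj C" using f g hom_Obj by blast+
  note pr = pr_hom[OF o]
  note c = Comp_hom[OF pr(1) f] Comp_hom[OF pr(2) g]
  have pm: "prod_map C f g = pair C (f \<cdot> pr1 C X Y) (g \<cdot> pr2 C X Y)"
    using homD[OF f] homD[OF g] by (simp add: prod_map_def)
  show "prod_map C f g \<in> hom C (prod_obj C X Y) (prod_obj C X' Y')"
    unfolding pm by (rule pair(1)[OF c])
  assume x: "x \<in> hom C Z X" and y: "y \<in> hom C Z Y"
  note p = pair[OF x y]
  show "prod_map C f g \<cdot> pair C x y = pair C (f \<cdot> x) (g \<cdot> y)"
    unfolding pm pair_comp[OF c p(1)]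
    using Comp_assoc[OF p(1) pr(1) f] Comp_assoc[OF p(1) pr(2) g] p by simp
qed

lemma diag_comp: "f \<in> hom C Z X \<Longrightarrow> diag C X \<cdot> f = pair C f f"
  unfolding diag_def using pair_comp Ident_Comp Ident_hom hom_Obj by metis

section \<open>Product projections as fibrations\<close>

text \<open>Parallel maps into \<open>T\<close> coincide, so any two maps into \<open>X\<close> and
  \<open>Y\<close> from a common domain form a cone over the cospan. This exhibits a projection as
  the pullback of a map into a terminal object.\<close>

lemma product_pullback:
  assumes pq: "is_product C X Y p q" and T: "terminal C T"
    and f: "f \<in> hom C X T" and g: "g \<in> hom C Y T"
  shows "is_pullback C f g p q"
proof -
  have eq: "f \<cdot> u = g \<cdot> v" if "u \<in> hom C Z X" "v \<in> hom C Z Y" for u v Z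
  proof -
    have "f \<cdot> u \<in> hom C Z T" "g \<cdot> v \<in> hom C Z T"
      using that f g Comp_hom by blast+
    then show ?thesis using T hom_Obj[OF that(1)] unfolding terminal_def by blast
  qed
  have "f \<cdot> p = g \<cdot> q" using eq pq unfolding is_product_def by blast
  with pq eq homD[OF f] homD[OF g] show ?thesis
    unfolding is_pullback_def is_product_def by simp
qed

text \<open>Pullback stability is stated for the first leg of a square; exchanging the factors makes
  it available for \<open>pr2\<close>.\<close>

lemma is_product_swap:
  assumes "is_product C X Y p q"
  shows "is_product C Y X q p"
proof -
  have "Dom C q = Dom C p" using assms unfolding is_product_def hom_def by simp
  then show ?thesis using assms unfolding is_product_def by metis
qed

lemma pr_Fib:
  assumes o: "X \<in> Obj C" "Y \<in> Obj C"
  shows "pr1 C X Y \<in> Fib C" "pr2 C X Y \<in> Fib C"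
proof -
  obtain T where T: "terminal C T" and fib: "\<And>X. hom C X T \<subseteq> Fib C"
    using terminal_ex by blast
  obtain f where f: "f \<in> hom C X T" using T o unfolding terminal_def by blast
  obtain g where g: "g \<in> hom C Y T" using T o unfolding terminal_def by blast
  note pr = product_pr[OF o]
  show "pr1 C X Y \<in> Fib C"
    using Fib_pullback[OF _ product_pullback[OF pr T f g]] fib g by blast
  show "pr2 C X Y \<in> Fib C"
    using Fib_pullback[OF _ product_pullback[OF is_product_swap[OF pr] T g f]] fib f by blast
qed

section \<open>Path objects, factorisation and lifting\<close>

text \<open>The constant paths \<open>r\<close> form a section of the first endpoint map, which is
  thus a weak equivalence by cancelling \<open>r\<close>, and a fibration as \<open>p\<close>
  followed by a projection.\<close>

lemma path_object:
  assumes P: "is_path_object C X r p" and X: "X \<in> Obj C"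
  shows "r \<in> hom C X (Dom C p)" "p \<in> hom C (Dom C p) (prod_obj C X X)"
    "pr1 C X X \<cdot> p \<in> hom C (Dom C p) X" "pr2 C X X \<cdot> p \<in> hom C (Dom C p) X"
    "(pr1 C X X \<cdot> p) \<cdot> r = Ident C X" "(pr2 C X X \<cdot> p) \<cdot> r = Ident C X"
    "pr1 C X X \<cdot> p \<in> Fib C \<inter> Weq C"
proof -
  show r: "r \<in> hom C X (Dom C p)" and p: "p \<in> hom C (Dom C p) (prod_obj C X X)"
    using P unfolding is_path_object_def by auto
  note pr = pr_hom[OF X X] and I = Ident_hom[OF X]
  show p1: "pr1 C X X \<cdot> p \<in> hom C (Dom C p) X" and "pr2 C X X \<cdot> p \<in> hom C (Dom C p) X"
    using Comp_hom[OF p] pr by blast+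
  have pr_r: "p \<cdot> r = pair C (Ident C X) (Ident C X)"
    using P unfolding is_path_object_def diag_def by simp
  show e: "(pr1 C X X \<cdot> p) \<cdot> r = Ident C X" and "(pr2 C X X \<cdot> p) \<cdot> r = Ident C X"
    using Comp_assoc[OF r p pr(1)] Comp_assoc[OF r p pr(2)] pr_r pair[OF I I] by simp_all
  have "pr1 C X X \<cdot> p \<in> Weq C"
    by (rule Weq_cancel_right[OF r p1])
      (use e Ident_Weq[OF X] P in \<open>auto simp: is_path_object_def\<close>)
  moreover have "pr1 C X X \<cdot> p \<in> Fib C"
    using Fib_Comp pr_Fib(1)[OF X X] P homD[OF p] homD[OF pr(1)]
    unfolding is_path_object_def by auto
  ultimately show "pr1 C X X \<cdot> p \<in> Fib C \<inter> Weq C" by blast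
qed

text \<open>The mapping path object: \<open>Y \<times>\<^sub>X PX\<close>, obtained as the pullback of \<open>PX\<close> along \<open>f \<times> id\<close>.\<close>

lemma factorization:
  assumes f: "f \<in> hom C Y X"
  obtains E w m where "w \<in> hom C Y E" "w \<in> Weq C" "m \<in> hom C E X" "m \<in> Fib C" "m \<cdot> w = f"
proof -
  have o: "Y \<in> Obj C" "X \<in> Obj C" using f hom_Obj by blast+
  obtain r p where P: "is_path_object C X r p" using path_object_ex o by blast
  note pp = path_object[OF P o(2)]
  let ?fi = "prod_map C f (Ident C X)"
  let ?s = "pr1 C X X \<cdot> p" and ?t = "pr2 C X X \<cdot> p"
  note I = Ident_hom[OF o(2)] Ident_hom[OF o(1)]
  note fi = prod_map[OF f I(1)]
  note prX = pr_hom[OF o(2) o(2)] and prYX = pr_hom[OF o]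
  have pF: "p \<in> Fib C" using P unfolding is_path_object_def by simp
  obtain a b where ab: "is_pullback C ?fi p a b"
    using Fib_pullback_ex[OF pF] homD[OF fi(1)] homD[OF pp(2)] by metis
  define E where "E = Dom C a"
  have a: "a \<in> hom C E (prod_obj C Y X)" and b: "b \<in> hom C E (Dom C p)"
    and fab: "?fi \<cdot> a = p \<cdot> b"
    using ab homD[OF fi(1)] unfolding is_pullback_def E_def by auto
  have univ: "\<exists>!k. k \<in> hom C Z E \<and> a \<cdot> k = u \<and> b \<cdot> k = v"
    if "u \<in> hom C Z (prod_obj C Y X)" "v \<in> hom C Z (Dom C p)" "?fi \<cdot> u = p \<cdot> v" for Z u v
    using ab that homD[OF fi(1)] unfolding is_pullback_def E_def by auto
  let ?d = "pr1 C Y X \<cdot> a" and ?m = "pr2 C Y X \<cdot> a"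
  have d: "?d \<in> hom C E Y" and m: "?m \<in> hom C E X"
    using Comp_hom[OF a] prYX by blast+
  have fia: "?fi \<cdot> a = pair C (f \<cdot> ?d) ?m"
    using fi(2)[OF d m] pair_eta[OF a o] Ident_Comp[OF m] by simp
  have aux: "pr1 C X X \<cdot> (p \<cdot> v) = ?s \<cdot> v" "pr2 C X X \<cdot> (p \<cdot> v) = ?t \<cdot> v"
    if "v \<in> hom C Z (Dom C p)" for Z v
    using Comp_assoc[OF that pp(2) prX(1)] Comp_assoc[OF that pp(2) prX(2)] by simp_all
  have fd: "f \<cdot> ?d = ?s \<cdot> b" and mt: "?m = ?t \<cdot> b"
    using pair[OF Comp_hom[OF d f] m] fia fab aux[OF b] by auto
  \<comment> \<open>The same object is the pullback of \<open>?s\<close> along \<open>f\<close>: the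
    second component of \<open>a\<close> is forced to be \<open>?t \<cdot> b\<close>, so a map into
    \<open>E\<close> is a point \<open>u\<close> of \<open>Y\<close> with a path starting at
    \<open>f \<cdot> u\<close>.\<close>
  have univ2: "\<exists>!k. k \<in> hom C Z E \<and> ?d \<cdot> k = u \<and> b \<cdot> k = v"
    if u: "u \<in> hom C Z Y" and v: "v \<in> hom C Z (Dom C p)" and e: "f \<cdot> u = ?s \<cdot> v" for Z u v
  proof -
    have tv: "?t \<cdot> v \<in> hom C Z X" using Comp_hom[OF v pp(4)] .
    have "?fi \<cdot> pair C u (?t \<cdot> v) = pair C (?s \<cdot> v) (?t \<cdot> v)"
      using fi(2)[OF u tv] Ident_Comp[OF tv] e by simp
    also have "\<dots> = p \<cdot> v"
      using pair_eta[OF Comp_hom[OF v pp(2)] o(2) o(2)] aux[OF v] by simp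
    finally have "\<exists>!k. k \<in> hom C Z E \<and> a \<cdot> k = pair C u (?t \<cdot> v) \<and> b \<cdot> k = v"
      using univ[OF pair(1)[OF u tv] v] by simp
    moreover have "a \<cdot> k = pair C u (?t \<cdot> v) \<longleftrightarrow> ?d \<cdot> k = u"
      if k: "k \<in> hom C Z E" and bk: "b \<cdot> k = v" for k
    proof
      assume "a \<cdot> k = pair C u (?t \<cdot> v)"
      then show "?d \<cdot> k = u" using Comp_assoc[OF k a prYX(1)] pair[OF u tv] by simp
    next
      assume dk: "?d \<cdot> k = u"
      have "?m \<cdot> k = ?t \<cdot> v" using mt Comp_assoc[OF k b pp(4)] bk by simp
      with dk show "a \<cdot> k = pair C u (?t \<cdot> v)"
        using pair_eta[OF Comp_hom[OF k a] o] Comp_assoc[OF k a prYX(1)]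
          Comp_assoc[OF k a prYX(2)] by simp
    qed
    ultimately show ?thesis by metis
  qed
  have pb: "is_pullback C f ?s ?d b"
    unfolding is_pullback_def
    using homD[OF f] homD[OF pp(3)] homD[OF d] d b fd univ2 by simp
  have dW: "?d \<in> Weq C" using acyclic_pullback[OF pp(7) pb] by blast
  have rf: "r \<cdot> f \<in> hom C Y (Dom C p)" using Comp_hom[OF f pp(1)] .
  have srf: "f \<cdot> Ident C Y = ?s \<cdot> (r \<cdot> f)"
    using Comp_assoc[OF f pp(1) pp(3)] pp(5) Comp_Ident[OF f] Ident_Comp[OF f] by simp
  \<comment> \<open>\<open>w\<close> attaches to a point the constant path at its image under
    \<open>f\<close>; being a section of the weak equivalence \<open>?d\<close>, it is one
    too.\<close>
  obtain w where w: "w \<in> hom C Y E" and dw: "?d \<cdot> w = Ident C Y" and bw: "b \<cdot> w = r \<cdot> f"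
    using univ2[OF I(2) rf srf] by blast
  have "w \<in> Weq C" using Weq_cancel_left[OF w d] dw dW Ident_Weq[OF o(1)] by simp
  moreover have "?m \<cdot> w = f"
    using mt Comp_assoc[OF w b pp(4)] bw Comp_assoc[OF f pp(1) pp(4)] pp(6) Ident_Comp[OF f]
    by simp
  moreover have "?m \<in> Fib C"
    using Fib_Comp[OF Fib_pullback[OF pF ab] pr_Fib(2)[OF o]] homD[OF a] homD[OF prYX(2)] by simp
  ultimately show thesis using that w m by blast
qed

text \<open>Only the lower triangle of the lifting square commutes strictly.\<close>

lemma lifting:
  assumes w: "w \<in> hom C A B" "w \<in> Weq C" and p: "p \<in> hom C E X" "p \<in> Fib C"
    and u: "u \<in> hom C A E" and v: "v \<in> hom C B X" and sq: "p \<cdot> u = v \<cdot> w"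
  shows "\<exists>l \<in> hom C B E. p \<cdot> l = v"
proof -
  have B: "B \<in> Obj C" using hom_Obj[OF v] by simp
  \<comment> \<open>A section of \<open>a\<close> followed by \<open>b\<close> is a lift of
    \<open>v\<close>, so the aim is a section of \<open>a\<close>.\<close>
  obtain a b where ab: "is_pullback C v p a b"
    using Fib_pullback_ex[OF p(2)] homD[OF v] homD[OF p(1)] by metis
  let ?D = "Dom C a"
  have a: "a \<in> hom C ?D B" and b: "b \<in> hom C ?D E" and e: "v \<cdot> a = p \<cdot> b"
    using ab homD[OF v] homD[OF p(1)] unfolding is_pullback_def by auto
  obtain k where k: "k \<in> hom C A ?D" "a \<cdot> k = w"
    using ab w(1) u sq homD[OF v] homD[OF p(1)] unfolding is_pullback_def by metis
  obtain F w' m where w': "w' \<in> hom C A F" "w' \<in> Weq C" and m: "m \<in> hom C F ?D" "m \<in> Fib C"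
    and mw: "m \<cdot> w' = k"
    using factorization[OF k(1)] by blast
  \<comment> \<open>Preceded by the weak equivalence \<open>w'\<close>, the fibration
    \<open>a \<cdot> m\<close> gives \<open>w\<close>, hence it is acyclic. Its section followed by
    \<open>m\<close> is a section of \<open>a\<close>.\<close>
  have am: "a \<cdot> m \<in> hom C F B" using Comp_hom[OF m(1) a] .
  have "(a \<cdot> m) \<cdot> w' = w" using Comp_assoc[OF w'(1) m(1) a] mw k by simp
  then have "a \<cdot> m \<in> Weq C" using Weq_cancel_right[OF w'(1) am] w w' by simp
  moreover have "a \<cdot> m \<in> Fib C"
    using Fib_Comp[OF m(2) Fib_pullback[OF p(2) ab]] homD[OF m(1)] by simp
  ultimately obtain s where s: "s \<in> hom C B F" "(a \<cdot> m) \<cdot> s = Ident C B"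
    using acyclic_section homD[OF am] by blast
  have ms: "m \<cdot> s \<in> hom C B ?D" using Comp_hom[OF s(1) m(1)] .
  have "p \<cdot> (b \<cdot> (m \<cdot> s)) = (v \<cdot> a) \<cdot> (m \<cdot> s)" using Comp_assoc[OF ms b p(1)] e by simp
  also have "\<dots> = v \<cdot> ((a \<cdot> m) \<cdot> s)"
    using Comp_assoc[OF ms a v] Comp_assoc[OF s(1) m(1) a] by simp
  also have "\<dots> = v" using s Comp_Ident[OF v] by simp
  finally show ?thesis using Comp_hom[OF ms b] by blast
qed

section \<open>Path objects as least homotopy equivalence relations\<close>

text \<open>Constant paths give reflexivity. Inverses and concatenations exist for constant paths,
  and lifting the prescribed endpoints through \<open>p\<close> against the weak equivalences
  \<open>r\<close> and \<open>k\<close> gives them for all paths.\<close>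

lemma path_object_equiv_rel:
  assumes P: "is_path_object C X r p" and X: "X \<in> Obj C"
  shows "is_homotopy_equiv_rel C X p"
proof -
  note pp = path_object[OF P X] and prX = pr_hom[OF X X] and I = Ident_hom[OF X]
  let ?s = "pr1 C X X \<cdot> p" and ?t = "pr2 C X X \<cdot> p"
  have p: "p \<in> Fib C" "r \<in> Weq C" "p \<cdot> r = diag C X"
    using P unfolding is_path_object_def by auto
  have proj: "?s \<cdot> l = x \<and> ?t \<cdot> l = y"
    if "l \<in> hom C Z (Dom C p)" "p \<cdot> l = pair C x y" "x \<in> hom C Z X" "y \<in> hom C Z X" for Z l x y
    using that pair[OF that(3,4)] Comp_assoc[OF that(1) pp(2)] prX by simp
  have "?t \<cdot> r = Ident C X" "?s \<cdot> r = Ident C X" using pp by simp_all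
  then have "p \<cdot> r = pair C ?t ?s \<cdot> r"
    using p(3) pair_comp[OF pp(4,3,1)] unfolding diag_def by simp
  then obtain \<sigma> where "\<sigma> \<in> hom C (Dom C p) (Dom C p)" "p \<cdot> \<sigma> = pair C ?t ?s"
    using lifting[OF pp(1) p(2) pp(2) p(1) pp(1) pair(1)[OF pp(4,3)]] by blast
  then have sym: "\<exists>\<sigma> \<in> hom C (Dom C p) (Dom C p). ?s \<cdot> \<sigma> = ?t \<and> ?t \<cdot> \<sigma> = ?s"
    using proj pp(3,4) by blast
  obtain a b where ab: "is_pullback C ?t ?s a b"
    using Fib_pullback_ex[of ?s ?t] pp(7) homD[OF pp(3)] homD[OF pp(4)] by auto
  let ?D = "Dom C a"
  have a: "a \<in> hom C ?D (Dom C p)" and b: "b \<in> hom C ?D (Dom C p)"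
    using ab homD[OF pp(3)] homD[OF pp(4)] unfolding is_pullback_def by auto
  \<comment> \<open>\<open>k\<close> pairs the constant path with itself. It is a weak equivalence
    because \<open>a \<cdot> k = r\<close> and \<open>a\<close> is a pullback of the acyclic
    fibration \<open>?s\<close>.\<close>
  obtain k where k: "k \<in> hom C X ?D" "a \<cdot> k = r" "b \<cdot> k = r"
    using ab pp(1,5,6) homD[OF pp(3)] homD[OF pp(4)] unfolding is_pullback_def by metis
  have "a \<in> Weq C" using acyclic_pullback[OF pp(7) ab] by blast
  then have kW: "k \<in> Weq C" using Weq_cancel_left[OF k(1) a] k p by simp
  note sa = Comp_hom[OF a pp(3)] and tb = Comp_hom[OF b pp(4)]
  have "(?s \<cdot> a) \<cdot> k = Ident C X" "(?t \<cdot> b) \<cdot> k = Ident C X"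
    using Comp_assoc[OF k(1) a pp(3)] Comp_assoc[OF k(1) b pp(4)] k pp by simp_all
  then have "p \<cdot> r = pair C (?s \<cdot> a) (?t \<cdot> b) \<cdot> k"
    using p(3) pair_comp[OF sa tb k(1)] unfolding diag_def by simp
  then obtain \<tau> where "\<tau> \<in> hom C ?D (Dom C p)" "p \<cdot> \<tau> = pair C (?s \<cdot> a) (?t \<cdot> b)"
    using lifting[OF k(1) kW pp(2) p(1) pp(1) pair(1)[OF sa tb]] by blast
  then have tr: "\<exists>\<tau> \<in> hom C ?D (Dom C p). ?s \<cdot> \<tau> = ?s \<cdot> a \<and> ?t \<cdot> \<tau> = ?t \<cdot> b"
    using proj sa tb by blast
  show ?thesis
    unfolding is_homotopy_equiv_rel_def Let_def
    using X p pp(1) homD[OF pp(2)] sym ab tr by blast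
qed

lemma path_object_Hex_Obj:
  "\<lbrakk>is_path_object C X r p; X \<in> Obj C\<rbrakk> \<Longrightarrow> (X, p) \<in> Hex_Obj C"
  unfolding Hex_Obj_def using path_object_equiv_rel by simp

text \<open>Over constant paths, reflexivity of \<open>s\<close> covers
  \<open>prod_map C f f\<close>; lifting against \<open>r\<close> then gives a map defined on all
  paths.\<close>

lemma path_object_hex_maps:
  assumes P: "is_path_object C X r p" and S: "is_homotopy_equiv_rel C Y s"
    and f: "f \<in> hom C X Y"
  shows "f \<in> hex_maps C (X, p) (Y, s)"
proof -
  have X: "X \<in> Obj C" using hom_Obj[OF f] by simp
  note pp = path_object[OF P X] and ss = equiv_rel_hom[OF S] and ff = prod_map[OF f f]
  note I = Ident_hom[OF X]
  obtain \<rho> where \<rho>: "\<rho> \<in> hom C Y (Dom C s)" "s \<cdot> \<rho> = diag C Y" and sF: "s \<in> Fib C"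
    using S unfolding is_homotopy_equiv_rel_def Let_def by blast
  have rW: "r \<in> Weq C" and pr: "p \<cdot> r = pair C (Ident C X) (Ident C X)"
    using P unfolding is_path_object_def diag_def by auto
  have "s \<cdot> (\<rho> \<cdot> f) = pair C f f"
    using Comp_assoc[OF f \<rho>(1) ss(2)] \<rho>(2) diag_comp[OF f] by simp
  also have "\<dots> = prod_map C f f \<cdot> (p \<cdot> r)"
    using ff(2)[OF I I] pr Comp_Ident[OF f] by simp
  also have "\<dots> = (prod_map C f f \<cdot> p) \<cdot> r"
    using Comp_assoc[OF pp(1,2) ff(1)] by simp
  finally have "\<exists>\<phi> \<in> hom C (Dom C p) (Dom C s). s \<cdot> \<phi> = prod_map C f f \<cdot> p"
    by (rule lifting[OF pp(1) rW ss(2) sF Comp_hom[OF f \<rho>(1)] Comp_hom[OF pp(2) ff(1)]])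
  then show ?thesis using f unfolding hex_maps_def by simp
qed

section \<open>Homotopy and relatedness\<close>

text \<open>The path object witnessing the homotopy is a relation that \<open>k\<close> respects,
  whatever \<open>s\<close> is. With an identity as \<open>k\<close>, homotopic maps are identified
  by every homotopy equivalence relation.\<close>

lemma homotopic_related:
  assumes fg: "homotopic C f g" and f: "f \<in> hom C Z X" and k: "k \<in> hom C X Y"
    and S: "is_homotopy_equiv_rel C Y s"
  shows "related Y s (k \<cdot> f) (k \<cdot> g)"
proof -
  obtain r p h where P: "is_path_object C X r p" and h: "h \<in> hom C Z (Dom C p)"
    "(pr1 C X X \<cdot> p) \<cdot> h = f" "(pr2 C X X \<cdot> p) \<cdot> h = g"
    using fg homD[OF f] unfolding homotopic_def by auto
  have R: "is_homotopy_equiv_rel C X p"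
    using path_object_equiv_rel[OF P] hom_Obj[OF f] by simp
  have "related X p f g" using related_iff[OF R f] h by blast
  with path_object_hex_maps[OF P S k] show ?thesis unfolding hex_maps_iff[OF R S] by blast
qed

lemma homotopicI:
  assumes P: "is_path_object C X r p" and fg: "related X p f g"
  shows "homotopic C f g"
proof -
  obtain Z where f: "f \<in> hom C Z X" and g: "g \<in> hom C Z X"
    using fg unfolding related_def by blast
  have R: "is_homotopy_equiv_rel C X p"
    using path_object_equiv_rel[OF P] hom_Obj[OF f] by simp
  show ?thesis
    using related_iff[OF R f] fg P homD[OF f] g unfolding homotopic_def by auto
qed

text \<open>The case of \<open>homotopic_related\<close> in which the relation on \<open>Y\<close>
  is a path object.\<close>

lemma homotopic_postcomp:
  assumes "homotopic C f g" "f \<in> hom C Z X" "k \<in> hom C X Y"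
  shows "homotopic C (k \<cdot> f) (k \<cdot> g)"
proof -
  have Y: "Y \<in> Obj C" using assms(3) hom_Obj by blast
  obtain r p where P: "is_path_object C Y r p" using path_object_ex[OF Y] by blast
  show ?thesis
    using homotopicI[OF P homotopic_related[OF assms path_object_equiv_rel[OF P Y]]] .
qed

lemma homotopic_refl:
  assumes f: "f \<in> hom C Z X"
  shows "homotopic C f f"
proof -
  have X: "X \<in> Obj C" using f hom_Obj by blast
  obtain r p where P: "is_path_object C X r p" using path_object_ex[OF X] by blast
  show ?thesis using homotopicI[OF P related_refl[OF path_object_equiv_rel[OF P X] f]] .
qed

section \<open>Uniqueness of recursion up to an equivalence relation\<close>

text \<open>A witness that \<open>f \<cdot> x\<close> and \<open>g \<cdot> x\<close> are related
  forms, with \<open>x\<close>, a cone over the pullback of \<open>s\<close> along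
  \<open>pair C f g\<close>. Relatedness thus becomes a strict factorisation through
  \<open>q\<close>.\<close>

lemma related_locus:
  assumes S: "is_homotopy_equiv_rel C Y s" and f: "f \<in> hom C X Y" and g: "g \<in> hom C X Y"
  obtains Q q where "q \<in> hom C Q X" "related Y s (f \<cdot> q) (g \<cdot> q)"
    "\<forall>Z. \<forall>x \<in> hom C Z X. related Y s (f \<cdot> x) (g \<cdot> x) \<longrightarrow> (\<exists>m \<in> hom C Z Q. q \<cdot> m = x)"
proof -
  note ss = equiv_rel_hom[OF S] and fg = pair[OF f g]
  have sF: "s \<in> Fib C" using S unfolding is_homotopy_equiv_rel_def by simp
  obtain q q' where pb: "is_pullback C (pair C f g) s q q'"
    using Fib_pullback_ex[OF sF] homD[OF fg(1)] homD[OF ss(2)] by metis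
  have q: "q \<in> hom C (Dom C q) X" and q': "q' \<in> hom C (Dom C q) (Dom C s)"
    and e: "pair C f g \<cdot> q = s \<cdot> q'"
    using pb homD[OF fg(1)] unfolding is_pullback_def by auto
  have "s \<cdot> q' = pair C (f \<cdot> q) (g \<cdot> q)" using e pair_comp[OF f g q] by simp
  then have 1: "related Y s (f \<cdot> q) (g \<cdot> q)"
    unfolding related_def using Comp_hom[OF q] f g q' by blast
  have 2: "\<exists>m \<in> hom C Z (Dom C q). q \<cdot> m = x"
    if x: "x \<in> hom C Z X" and r: "related Y s (f \<cdot> x) (g \<cdot> x)" for Z x
  proof -
    \<comment> \<open>\<open>related\<close> hides the common domain under an existential
      quantifier; the domain of \<open>f \<cdot> x\<close> determines it.\<close>
    have "Z' = Z" if "f \<cdot> x \<in> hom C Z' Y" for Z'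
      using homD[OF that] homD[OF Comp_hom[OF x f]] by simp
    then have "\<exists>H \<in> hom C Z (Dom C s). s \<cdot> H = pair C (f \<cdot> x) (g \<cdot> x)"
      using r unfolding related_def by blast
    then obtain H where H: "H \<in> hom C Z (Dom C s)" "pair C f g \<cdot> x = s \<cdot> H"
      using pair_comp[OF f g x] by auto
    with pb x show ?thesis using homD[OF fg(1)] unfolding is_pullback_def by metis
  qed
  show thesis using that[OF q 1] 2 by blast
qed

text \<open>\<open>h\<close> and \<open>h'\<close> solve the recursion only up to \<open>s\<close>,
  while the uniqueness clause for \<open>N\<close> speaks of homotopy. It is therefore applied to
  two endomaps of \<open>N\<close>, namely \<open>q \<cdot> k\<close> and the identity.\<close>

lemma homotopy_nno_unique_related:
  assumes N: "is_homotopy_nno C T N z \<sigma>" and S: "is_homotopy_equiv_rel C Y s"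
    and g: "g \<in> hom C Y Y" "\<And>x y. related Y s x y \<Longrightarrow> related Y s (g \<cdot> x) (g \<cdot> y)"
    and h: "h \<in> hom C N Y" "related Y s (h \<cdot> z) y" "related Y s (h \<cdot> \<sigma>) (g \<cdot> h)"
    and h': "h' \<in> hom C N Y" "related Y s (h' \<cdot> z) y" "related Y s (h' \<cdot> \<sigma>) (g \<cdot> h')"
  shows "related Y s h h'"
proof -
  have z: "z \<in> hom C T N" and \<sigma>: "\<sigma> \<in> hom C N N"
    using N unfolding is_homotopy_nno_def by auto
  note rsym = related_sym[OF S] and rtrans = related_trans[OF S]
  obtain Q q where q: "q \<in> hom C Q N" and hq: "related Y s (h \<cdot> q) (h' \<cdot> q)"
    and lift: "\<forall>Z. \<forall>x \<in> hom C Z N. related Y s (h \<cdot> x) (h' \<cdot> x) \<longrightarrow>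
      (\<exists>m \<in> hom C Z Q. q \<cdot> m = x)"
    by (rule related_locus[OF S h(1) h'(1)])
  obtain z' where z': "z' \<in> hom C T Q" "q \<cdot> z' = z"
    using lift z rtrans[OF h(2) rsym[OF h'(2)]] by blast
  have \<sigma>q: "\<sigma> \<cdot> q \<in> hom C Q N" using Comp_hom[OF q \<sigma>] .
  \<comment> \<open>The locus is closed under successor: along \<open>q\<close>,
    \<open>h \<cdot> \<sigma>\<close> is related to \<open>g \<cdot> h\<close>, then to
    \<open>g \<cdot> h'\<close> because \<open>g\<close> preserves \<open>s\<close>, then to
    \<open>h' \<cdot> \<sigma>\<close>.\<close>
  have "related Y s ((h \<cdot> \<sigma>) \<cdot> q) ((g \<cdot> h) \<cdot> q)"
    using related_precomp[OF S h(3) Comp_hom[OF \<sigma> h(1)] q] .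
  moreover have "related Y s ((g \<cdot> h) \<cdot> q) ((g \<cdot> h') \<cdot> q)"
    using g(2)[OF hq] Comp_assoc[OF q h(1) g(1)] Comp_assoc[OF q h'(1) g(1)] by simp
  moreover have "related Y s ((g \<cdot> h') \<cdot> q) ((h' \<cdot> \<sigma>) \<cdot> q)"
    using rsym[OF related_precomp[OF S h'(3) Comp_hom[OF \<sigma> h'(1)] q]] .
  ultimately have "related Y s (h \<cdot> (\<sigma> \<cdot> q)) (h' \<cdot> (\<sigma> \<cdot> q))"
    using rtrans Comp_assoc[OF q \<sigma> h(1)] Comp_assoc[OF q \<sigma> h'(1)] by metis
  then obtain \<sigma>' where \<sigma>': "\<sigma>' \<in> hom C Q Q" "q \<cdot> \<sigma>' = \<sigma> \<cdot> q"
    using lift \<sigma>q by blast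
  obtain k where k: "k \<in> hom C N Q" "homotopic C (k \<cdot> z) z'" "homotopic C (k \<cdot> \<sigma>) (\<sigma>' \<cdot> k)"
    using N z'(1) \<sigma>'(1) unfolding is_homotopy_nno_def by meson
  \<comment> \<open>Since \<open>q\<close> carries \<open>z'\<close> and \<open>\<sigma>'\<close>
    strictly to \<open>z\<close> and \<open>\<sigma>\<close>, \<open>?e\<close> solves the recursion
    on \<open>N\<close> with data \<open>z\<close>, \<open>\<sigma>\<close>, as does the
    identity.\<close>
  let ?e = "q \<cdot> k"
  have e: "?e \<in> hom C N N" using Comp_hom[OF k(1) q] .
  have ez: "homotopic C (?e \<cdot> z) z"
    using homotopic_postcomp[OF k(2) Comp_hom[OF z k(1)] q] z'(2) Comp_assoc[OF z k(1) q] by simp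
  have "q \<cdot> (\<sigma>' \<cdot> k) = \<sigma> \<cdot> ?e"
    using Comp_assoc[OF k(1) \<sigma>'(1) q] Comp_assoc[OF k(1) q \<sigma>] \<sigma>'(2) by simp
  then have e\<sigma>: "homotopic C (?e \<cdot> \<sigma>) (\<sigma> \<cdot> ?e)"
    using homotopic_postcomp[OF k(3) Comp_hom[OF \<sigma> k(1)] q] Comp_assoc[OF \<sigma> k(1) q] by simp
  let ?i = "Ident C N"
  have i: "?i \<in> hom C N N" using Ident_hom hom_Obj[OF z] by blast
  have iz: "homotopic C (?i \<cdot> z) z" "homotopic C (?i \<cdot> \<sigma>) (\<sigma> \<cdot> ?i)"
    using homotopic_refl[OF z] homotopic_refl[OF \<sigma>] Ident_Comp[OF z] Ident_Comp[OF \<sigma>]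
      Comp_Ident[OF \<sigma>] by simp_all
  \<comment> \<open>\<open>j\<close> is the solution provided by the definition for the data
    \<open>z\<close>, \<open>\<sigma>\<close>; the comparison of \<open>?e\<close> with the identity
    passes through it.\<close>
  obtain j where j: "homotopic C ?e j" "homotopic C ?i j"
    using N z \<sigma> e i ez e\<sigma> iz unfolding is_homotopy_nno_def by meson
  have ei: "related Y s f (f \<cdot> ?e)" if f: "f \<in> hom C N Y" for f
    using rtrans[OF homotopic_related[OF j(2) i f S] rsym[OF homotopic_related[OF j(1) e f S]]]
      Comp_Ident[OF f] by simp
  have "related Y s (h \<cdot> ?e) (h' \<cdot> ?e)"
    using related_precomp[OF S hq Comp_hom[OF q h(1)] k(1)]
      Comp_assoc[OF k(1) q h(1)] Comp_assoc[OF k(1) q h'(1)] by simp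
  then show ?thesis using ei[OF h(1)] rsym[OF ei[OF h'(1)]] rtrans by blast
qed

section \<open>The natural numbers object of \<open>Hex C\<close>\<close>

lemma hex_class_eq_iff:
  assumes "A \<in> Hex_Obj C" "(Y, s) \<in> Hex_Obj C"
    and "f \<in> hex_maps C A (Y, s)" "g \<in> hex_maps C A (Y, s)"
  shows "(A, hex_rel C A (Y, s) `` {f}, (Y, s)) = (A, hex_rel C A (Y, s) `` {g}, (Y, s))
    \<longleftrightarrow> related Y s f g"
proof -
  obtain X p where A: "A = (X, p)" by (cases A)
  show ?thesis
    using eq_equiv_class_iff[OF equiv_hex_rel[OF assms(1,2)] assms(3,4)] assms(3,4)
    unfolding A by (simp add: hex_rel_iff)
qed

text \<open>Parallel maps into \<open>T\<close> are equal, so by reflexivity every map into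
  \<open>T\<close> respects relations; a single representative leaves a single class.\<close>

lemma terminal_Hex:
  assumes T: "terminal C T" and P: "is_path_object C T r p"
  shows "terminal (Hex C) (T, p)"
proof -
  have TO: "T \<in> Obj C" using T unfolding terminal_def by blast
  note Tp = path_object_Hex_Obj[OF P TO] and S = path_object_equiv_rel[OF P TO]
  have eq: "f = g" if "f \<in> hom C X T" "g \<in> hom C X T" for f g X
    using T that hom_Obj[OF that(1)] unfolding terminal_def by blast
  have "\<exists>!F. F \<in> hom (Hex C) A (T, p)" if AO: "A \<in> Hex_Obj C" for A
  proof -
    obtain X s where A: "A = (X, s)" by (cases A)
    with AO have R: "is_homotopy_equiv_rel C X s" by (simp add: Hex_Obj_def)
    obtain f where f: "f \<in> hom C X T"
      using T equiv_rel_hom(1)[OF R] unfolding terminal_def by blast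
    have "related T p (f \<cdot> x) (f \<cdot> y)" if xy: "related X s x y" for x y
    proof -
      obtain Z where "x \<in> hom C Z X" "y \<in> hom C Z X" using xy unfolding related_def by blast
      then have "f \<cdot> x \<in> hom C Z T" "f \<cdot> y \<in> hom C Z T" using Comp_hom f by blast+
      then show ?thesis using eq related_refl[OF S] by metis
    qed
    then have fm: "f \<in> hex_maps C A (T, p)" unfolding A hex_maps_iff[OF R S] using f by blast
    have "g = f" if "g \<in> hex_maps C A (T, p)" for g
      using eq[OF _ f] hex_maps_hom[OF that] A by simp
    then show ?thesis unfolding hex_hom_iff using AO Tp fm by metis
  qed
  then show ?thesis using Tp unfolding terminal_def by (simp add: Hex_def)
qed

text \<open>With path objects as relations, every map out of \<open>T\<close> or \<open>N\<close>
  represents an arrow, so \<open>z\<close>, \<open>\<sigma>\<close> and all maps defined by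
  recursion pass to \<open>Hex C\<close>.\<close>

lemma nno_Hex:
  assumes N: "is_homotopy_nno C T N z \<sigma>"
    and PT: "is_path_object C T rT pT" and PN: "is_path_object C N rN pN"
  defines "T' \<equiv> (T, pT)" and "N' \<equiv> (N, pN)"
  shows "is_nno (Hex C) T' N' (T', hex_rel C T' N' `` {z}, N') (N', hex_rel C N' N' `` {\<sigma>}, N')"
proof -
  have T: "terminal C T" and z: "z \<in> hom C T N" and \<sigma>: "\<sigma> \<in> hom C N N"
    using N unfolding is_homotopy_nno_def by auto
  have o: "T \<in> Obj C" "N \<in> Obj C" using hom_Obj[OF z] by simp_all
  have T': "T' \<in> Hex_Obj C" and N': "N' \<in> Hex_Obj C"
    unfolding T'_def N'_def using path_object_Hex_Obj PT PN o by simp_all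
  note RN = path_object_equiv_rel[OF PN o(2)]
  have zm: "z \<in> hex_maps C T' N'" and \<sigma>m: "\<sigma> \<in> hex_maps C N' N'"
    unfolding T'_def N'_def
    using path_object_hex_maps[OF PT RN z] path_object_hex_maps[OF PN RN \<sigma>] by simp_all
  have "\<exists>!H. H \<in> hom (Hex C) N' B \<and> Comp (Hex C) H (T', hex_rel C T' N' `` {z}, N') = F \<and>
      Comp (Hex C) H (N', hex_rel C N' N' `` {\<sigma>}, N') = Comp (Hex C) G H"
    if F: "F \<in> hom (Hex C) T' B" and G: "G \<in> hom (Hex C) B B" for B F G
  proof -
    obtain Y s where B: "B = (Y, s)" by (cases B)
    from F G obtain y g where BO: "B \<in> Hex_Obj C" and ym: "y \<in> hex_maps C T' B"
      and gm: "g \<in> hex_maps C B B" and FG: "F = (T', hex_rel C T' B `` {y}, B)"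
      "G = (B, hex_rel C B B `` {g}, B)"
      unfolding hex_hom_iff by blast
    have S: "is_homotopy_equiv_rel C Y s" using BO B by (simp add: Hex_Obj_def)
    have y: "y \<in> hom C T Y" using hex_maps_hom[OF ym] B by (simp add: T'_def)
    have g: "g \<in> hom C Y Y" "\<And>x y. related Y s x y \<Longrightarrow> related Y s (g \<cdot> x) (g \<cdot> y)"
      using gm unfolding B hex_maps_iff[OF S S] by blast+
    let ?cl = "\<lambda>h. (N', hex_rel C N' B `` {h}, B)"
    \<comment> \<open>Composites are computed on representatives, so the two equations in
      \<open>Hex C\<close> say that the representative solves the recursion up to
      \<open>s\<close>.\<close>
    have solution: "Comp (Hex C) (?cl h) (T', hex_rel C T' N' `` {z}, N') = F \<and>
        Comp (Hex C) (?cl h) (N', hex_rel C N' N' `` {\<sigma>}, N') = Comp (Hex C) G (?cl h)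
      \<longleftrightarrow> related Y s (h \<cdot> z) y \<and> related Y s (h \<cdot> \<sigma>) (g \<cdot> h)"
      if h: "h \<in> hex_maps C N' B" for h
      unfolding FG Hex_Comp_class[OF T' N' BO zm h] Hex_Comp_class[OF N' N' BO \<sigma>m h]
        Hex_Comp_class[OF N' BO BO h gm]
      using hex_class_eq_iff[OF T' BO[unfolded B]
          Comp_hex_maps[OF T' N' BO zm h, unfolded B] ym[unfolded B]]
        hex_class_eq_iff[OF N' BO[unfolded B] Comp_hex_maps[OF N' N' BO \<sigma>m h, unfolded B]
          Comp_hex_maps[OF N' BO BO h gm, unfolded B]] B by simp
    obtain h where h: "h \<in> hom C N Y" "homotopic C (h \<cdot> z) y" "homotopic C (h \<cdot> \<sigma>) (g \<cdot> h)"
      using N y g(1) unfolding is_homotopy_nno_def by meson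
    have hm: "h \<in> hex_maps C N' B"
      unfolding N'_def B by (rule path_object_hex_maps[OF PN S h(1)])
    \<comment> \<open>Composing with this identity lets \<open>homotopic_related\<close> turn the
      homotopies for \<open>h\<close> into relatedness by \<open>s\<close>.\<close>
    have I: "Ident C Y \<in> hom C Y Y" using Ident_hom hom_Obj[OF y] by blast
    have hs: "related Y s (h \<cdot> z) y" "related Y s (h \<cdot> \<sigma>) (g \<cdot> h)"
      using homotopic_related[OF h(2) Comp_hom[OF z h(1)] I S]
        homotopic_related[OF h(3) Comp_hom[OF \<sigma> h(1)] I S]
        Ident_Comp[OF y] Ident_Comp[OF Comp_hom[OF z h(1)]]
        Ident_Comp[OF Comp_hom[OF \<sigma> h(1)]] Ident_Comp[OF Comp_hom[OF h(1) g(1)]] by simp_all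
    have uniq: "?cl k = ?cl h"
      if km: "k \<in> hex_maps C N' B"
        and ks: "related Y s (k \<cdot> z) y" "related Y s (k \<cdot> \<sigma>) (g \<cdot> k)" for k
    proof -
      have k: "k \<in> hom C N Y" using hex_maps_hom[OF km] B by (simp add: N'_def)
      show ?thesis
        using homotopy_nno_unique_related[OF N S g k ks h(1) hs]
          hex_class_eq_iff[OF N' BO[unfolded B] km[unfolded B] hm[unfolded B]] B by simp
    qed
    show ?thesis
    proof (rule ex1I[of _ "?cl h"], intro conjI)
      show "?cl h \<in> hom (Hex C) N' B" unfolding hex_hom_iff using N' BO hm by blast
      show "Comp (Hex C) (?cl h) (T', hex_rel C T' N' `` {z}, N') = F"
        "Comp (Hex C) (?cl h) (N', hex_rel C N' N' `` {\<sigma>}, N') = Comp (Hex C) G (?cl h)"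
        using solution[OF hm] hs by blast+
    next
      fix K
      assume K: "K \<in> hom (Hex C) N' B \<and> Comp (Hex C) K (T', hex_rel C T' N' `` {z}, N') = F \<and>
        Comp (Hex C) K (N', hex_rel C N' N' `` {\<sigma>}, N') = Comp (Hex C) G K"
      then obtain k where k: "k \<in> hex_maps C N' B" "K = ?cl k" unfolding hex_hom_iff by blast
      show "K = ?cl h" using uniq[OF k(1)] solution[OF k(1)] K unfolding k(2) by blast
    qed
  qed
  moreover have "(T', hex_rel C T' N' `` {z}, N') \<in> hom (Hex C) T' N'"
    "(N', hex_rel C N' N' `` {\<sigma>}, N') \<in> hom (Hex C) N' N'"
    unfolding hex_hom_iff using T' N' zm \<sigma>m by blast+
  moreover have "terminal (Hex C) T'" unfolding T'_def by (rule terminal_Hex[OF T PT])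
  ultimately show ?thesis unfolding is_nno_def by blast
qed

end

theorem proposition4p14:
  fixes C :: "('o, 'a) path_cat"
  assumes "path_category C"
    and "has_homotopy_nno C"
  shows "has_nno (Hex C)"
proof -
  interpret path_category C by fact
  obtain T N z s where N: "is_homotopy_nno C T N z s"
    using assms(2) unfolding has_homotopy_nno_def by blast
  then have "T \<in> Obj C" "N \<in> Obj C"
    using hom_Obj unfolding is_homotopy_nno_def by blast+
  then obtain rT pT rN pN where "is_path_object C T rT pT" "is_path_object C N rN pN"
    using path_object_ex by meson
  from nno_Hex[OF N this] show ?thesis unfolding has_nno_def by blast
qed

end
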